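(* Let $n\ge 0$ and let $i\ge j\ge 0$ be integers with $i+j\le n$ and $i+j\equiv n \pmod 2$. Let $$\mathcal{M}^{(2)}_{n,i;j}=\{(P,Q): P,Q \text{ paths of length } n,\ -P\le Q\le P,\ h(P)=i+j,\ h(Q)=i-j\},$$ $$\mathcal{P}^{(2)}_{n,i;j}=\{(P,Q): P,Q \text{ paths of length } n,\ 0\le Q\le P,\ i-j\le h(Q)\le i+j\le h(P)\}.$$ Then the map $\varphi$ (defined in the context) is a bijection from $\mathcal{M}^{(2)}_{n,i;j}$ onto $\mathcal{P}^{(2)}_{n,i;j}$.
   Context: A path of length $n$ is a lattice path in $\mathbb{Z}^2$ starting at $(0,0)$ with $n$ steps, each $U=(1,1)$ or $D=(1,-1)$. For $0\le a\le n$, $h_a(P)$ is the $y$-coordinate of $P$ at $x=a$, and $h(P)=h_n(P)$. We write $Q\le P$ if $h_a(Q)\le h_a(P)$ for all $a$; $0\le Q$ means $h_a(Q)\ge 0$ for all $a$; $-P$ is the reflection of $P$ in the $x$-axis. Flipping a step means changing it from $U$ to $D$ or vice versa. For paths $P,Q$ of length $n$, the disagreement path $(P-Q)/2$ is the path with steps $U$, $D$, $H=(1,0)$ whose height at each $a$ is $(h_a(P)-h_a(Q))/2$ (its $l$-th step is $U$ if $P$ has $U$ and $Q$ has $D$ there, $D$ if $P$ has $D$ and $Q$ has $U$, and $H$ if they agree). Matching in a path with steps $U,D,H$: ignoring $H$ steps and reading left to right, regard each $U$ as an opening parenthesis and each $D$ as a closing parenthesis, and match each $D$ with the nearest preceding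 not-yet-matched $U$, if one exists (equivalently, a $U$ and a $D$ are matched when they face each other at the same height with the path staying above the segment joining their midpoints). Steps $U$ or $D$ not matched are called unmatched. The map $\varphi$: given $(P,Q)\in\mathcal{M}^{(2)}_{n,i;j}$, (1) let $Q'$ be the path obtained from $Q$ by flipping every step of $Q$ whose endpoint lies strictly below the $x$-axis; (2) let $\chi$ be the set of positions of the unmatched $D$ steps of $(P-Q')/2$, and let $\widetilde P,\widetilde Q$ be obtained from $P$ and $Q'$ respectively by flipping the steps in positions $\chi$. Then $\varphi(P,Q)=(\widetilde P,\widetilde Q)$. *)

theory Defs
  imports Main
begin

section \<open>Lattice paths\<close>

text \<open>A path of length \<open>n\<close> is the list of its \<open>n\<close> steps. The step \<open>p ! l\<close> goes
  from abscissa \<open>l\<close> to abscissa \<open>l + 1\<close>; positions of steps are counted from 0.\<close>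

datatype step = Up | Down

fun rise :: "step \<Rightarrow> int" where
  "rise Up = 1"
| "rise Down = - 1"

fun flip :: "step \<Rightarrow> step" where
  "flip Up = Down"
| "flip Down = Up"

definition height_at :: "step list \<Rightarrow> nat \<Rightarrow> int" where
  "height_at p a = (\<Sum>l<a. rise (p ! l))"

definition height :: "step list \<Rightarrow> int" where
  "height p = height_at p (length p)"

definition path_le :: "step list \<Rightarrow> step list \<Rightarrow> bool" where
  "path_le q p \<longleftrightarrow> length q = length p \<and> (\<forall>a\<le>length p. height_at q a \<le> height_at p a)"

definition path_nonneg :: "step list \<Rightarrow> bool" where
  "path_nonneg p \<longleftrightarrow> (\<forall>a\<le>length p. 0 \<le> height_at p a)"

definition reflect :: "step list \<Rightarrow> step list" where
  "reflect p = map flip p"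

lemma height_at_reflect:
  assumes "a \<le> length p"
  shows "height_at (reflect p) a = - height_at p a"
proof -
  have "rise (flip s) = - rise s" for s
    by (cases s) auto
  then show ?thesis
    using assms by (simp add: height_at_def reflect_def sum_negf)
qed

definition flip_at :: "nat set \<Rightarrow> step list \<Rightarrow> step list" where
  "flip_at S p = map (\<lambda>l. if l \<in> S then flip (p ! l) else p ! l) [0..<length p]"


section \<open>Disagreement paths and matching\<close>

datatype mstep = MU | MD | MH

fun mrise :: "mstep \<Rightarrow> int" where
  "mrise MU = 1"
| "mrise MD = - 1"
| "mrise MH = 0"

fun disagree_step :: "step \<Rightarrow> step \<Rightarrow> mstep" where
  "disagree_step Up Down = MU"
| "disagree_step Down Up = MD"
| "disagree_step Up Up = MH"
| "disagree_step Down Down = MH"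

text \<open>The path \<open>(P - Q) / 2\<close>, for paths of the same length.\<close>

definition disagreement :: "step list \<Rightarrow> step list \<Rightarrow> mstep list" where
  "disagreement p q = map2 disagree_step p q"

lemma disagreement_height:
  assumes "length p = length q" "a \<le> length p"
  shows "2 * (\<Sum>l<a. mrise (disagreement p q ! l)) = height_at p a - height_at q a"
proof -
  have "2 * mrise (disagree_step s t) = rise s - rise t" for s t
    by (cases s; cases t) auto
  then show ?thesis
    using assms by (simp add: height_at_def disagreement_def sum_distrib_left sum_subtractf)
qed

text \<open>\<open>matching_from k us w\<close> reads \<open>w\<close> from left to right, its first step being at
  position \<open>k\<close>. The list \<open>us\<close> contains the positions of the up steps read before \<open>w\<close>
  that are not yet matched, the nearest one first. The result is the set of pairs
  \<open>(u, d)\<close> such that the down step at \<open>d\<close> in \<open>w\<close> gets matched with the up step at \<open>u\<close>.\<close>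

fun matching_from :: "nat \<Rightarrow> nat list \<Rightarrow> mstep list \<Rightarrow> (nat \<times> nat) set" where
  "matching_from k us [] = {}"
| "matching_from k us (MH # w) = matching_from (Suc k) us w"
| "matching_from k us (MU # w) = matching_from (Suc k) (k # us) w"
| "matching_from k [] (MD # w) = matching_from (Suc k) [] w"
| "matching_from k (u # us) (MD # w) = insert (u, k) (matching_from (Suc k) us w)"

definition matching :: "mstep list \<Rightarrow> (nat \<times> nat) set" where
  "matching w = matching_from 0 [] w"

definition unmatched_downs :: "mstep list \<Rightarrow> nat set" where
  "unmatched_downs w = {d. d < length w \<and> w ! d = MD \<and> (\<nexists>u. (u, d) \<in> matching w)}"


section \<open>The two sets of pairs and the map between them\<close>

definition M2 :: "nat \<Rightarrow> int \<Rightarrow> int \<Rightarrow> (step list \<times> step list) set" where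
  "M2 n i j = {(p, q). length p = n \<and> length q = n \<and>
     path_le (reflect p) q \<and> path_le q p \<and> height p = i + j \<and> height q = i - j}"

definition P2 :: "nat \<Rightarrow> int \<Rightarrow> int \<Rightarrow> (step list \<times> step list) set" where
  "P2 n i j = {(p, q). length p = n \<and> length q = n \<and>
     path_nonneg q \<and> path_le q p \<and> i - j \<le> height q \<and> height q \<le> i + j \<and> i + j \<le> height p}"

text \<open>The endpoint of a step is its right end, at abscissa \<open>l + 1\<close> for the step at
  position \<open>l\<close>; it is taken in the given path, before any flip.\<close>

definition flip_below :: "step list \<Rightarrow> step list" where
  "flip_below q = flip_at {l. l < length q \<and> height_at q (Suc l) < 0} q"

definition phi :: "step list \<times> step list \<Rightarrow> step list \<times> step list" where
  "phi = (\<lambda>(p, q).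
     let q' = flip_below q;
         \<chi> = unmatched_downs (disagreement p q')
     in (flip_at \<chi> p, flip_at \<chi> q'))"

end

theory Submission
  imports Defs
begin

text \<open>The map \<open>phi\<close> is a left-to-right transducer: the image of \<open>(p @ [s], q @ [t])\<close> extends the
  image \<open>(P, Q)\<close> of \<open>(p, q)\<close> by one step each, and these two steps depend only on \<open>s\<close>, \<open>t\<close> and the
  heights of \<open>p\<close>, \<open>q\<close> and \<open>Q\<close>, because \<open>(height p - height Q) / 2\<close> is the number of unmatched up
  steps read so far. Now let the end heights \<open>x \<ge> \<bar>y\<bar>\<close> of \<open>(p, q)\<close> be arbitrary, \<open>y\<close> possibly negative.
  The transducer maintains \<open>\<bar>y\<bar> \<le> height Q \<le> x \<le> height P\<close>, and every single transition can be
  undone uniquely within these bounds. Induction on the length then gives a bijection for all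
  \<open>x\<close> and \<open>y\<close> at once.\<close>

section \<open>Heights, path order and flips when one step is appended\<close>

lemma height_at_snoc: "a \<le> length p \<Longrightarrow> height_at (p @ [s]) a = height_at p a"
  by (auto simp: height_at_def nth_append intro!: sum.cong)

lemma height_Nil [simp]: "height [] = 0"
  by (simp add: height_def height_at_def)

lemma height_snoc [simp]: "height (p @ [s]) = height p + rise s"
proof -
  have "height (p @ [s]) = height_at (p @ [s]) (length p) + rise s"
    by (simp add: height_def height_at_def)
  then show ?thesis
    by (simp add: height_at_snoc height_def)
qed

lemma height_at_snoc_end [simp]: "height_at (p @ [s]) (Suc (length p)) = height p + rise s"
  using height_snoc[of p s] by (simp add: height_def)

lemma height_parity: "even (height p + int (length p))"
proof (induction p rule: rev_induct)
  case (snoc s p)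
  then show ?case by (cases s) auto
qed simp

lemma height_reflect: "height (reflect p) = - height p"
  using height_at_reflect[of "length p" p] by (simp add: height_def reflect_def)

lemma reflect_snoc: "reflect (p @ [s]) = reflect p @ [flip s]"
  by (simp add: reflect_def)

lemma length_reflect [simp]: "length (reflect p) = length p"
  by (simp add: reflect_def)

lemma path_le_snoc:
  assumes "length q = length p"
  shows "path_le (q @ [t]) (p @ [s]) \<longleftrightarrow> path_le q p \<and> height q + rise t \<le> height p + rise s"
  using assms height_at_snoc_end[of q t]
  by (auto simp: path_le_def le_Suc_eq height_at_snoc)

lemma path_nonneg_snoc: "path_nonneg (q @ [t]) \<longleftrightarrow> path_nonneg q \<and> 0 \<le> height q + rise t"
  by (auto simp: path_nonneg_def le_Suc_eq height_at_snoc)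

lemma path_le_heightD: "path_le q p \<Longrightarrow> height q \<le> height p"
  by (auto simp: path_le_def height_def)

lemma path_nonneg_heightD: "path_nonneg q \<Longrightarrow> 0 \<le> height q"
  by (auto simp: path_nonneg_def height_def)

lemma length_flip_at [simp]: "length (flip_at S p) = length p"
  by (simp add: flip_at_def)

lemma flip_at_snoc:
  "flip_at S (p @ [s]) = flip_at S p @ [if length p \<in> S then flip s else s]"
  by (simp add: flip_at_def nth_append)

lemma flip_at_cong:
  "(\<And>l. l < length p \<Longrightarrow> l \<in> S \<longleftrightarrow> l \<in> T) \<Longrightarrow> flip_at S p = flip_at T p"
  by (simp add: flip_at_def)

lemma length_flip_below [simp]: "length (flip_below q) = length q"
  by (simp add: flip_below_def)

lemma flip_below_snoc:
  "flip_below (q @ [t]) = flip_below q @ [if height q + rise t < 0 then flip t else t]"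
  unfolding flip_below_def flip_at_snoc
  by (auto simp: height_at_snoc intro!: flip_at_cong)

section \<open>Matching when one step is appended\<close>

text \<open>The stack \<open>us\<close> with which \<^const>\<open>matching_from\<close> arrives at the end of the word.\<close>

fun open_ups :: "nat \<Rightarrow> nat list \<Rightarrow> mstep list \<Rightarrow> nat list" where
  "open_ups k us [] = us"
| "open_ups k us (MH # w) = open_ups (Suc k) us w"
| "open_ups k us (MU # w) = open_ups (Suc k) (k # us) w"
| "open_ups k [] (MD # w) = open_ups (Suc k) [] w"
| "open_ups k (u # us) (MD # w) = open_ups (Suc k) us w"

lemma open_ups_snoc:
  "open_ups k us (w @ [m]) =
    (case m of MH \<Rightarrow> open_ups k us w | MU \<Rightarrow> (k + length w) # open_ups k us w
       | MD \<Rightarrow> tl (open_ups k us w))"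
proof (induction k us w rule: open_ups.induct)
  case (1 k us)
  then show ?case by (cases m; cases us) auto
qed (simp_all split: mstep.splits)

lemma matching_from_snoc:
  "matching_from k us (w @ [m]) = matching_from k us w \<union>
    (if m = MD \<and> open_ups k us w \<noteq> [] then {(hd (open_ups k us w), k + length w)} else {})"
proof (induction k us w rule: open_ups.induct)
  case (1 k us)
  then show ?case by (cases m; cases us) auto
qed auto

lemma matching_from_bound: "(u, d) \<in> matching_from k us w \<Longrightarrow> d < k + length w"
  by (induction k us w rule: open_ups.induct) auto

lemma unmatched_downs_bound: "d \<in> unmatched_downs w \<Longrightarrow> d < length w"
  by (simp add: unmatched_downs_def)

text \<open>A later step never changes the partner of an earlier down step, and a new down step
  lacks a partner only if the stack is empty.\<close>

lemma unmatched_downs_snoc: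
  "unmatched_downs (w @ [m]) =
    unmatched_downs w \<union> (if m = MD \<and> open_ups 0 [] w = [] then {length w} else {})"
  using matching_from_bound[of _ "length w" 0 "[]" w]
  by (auto simp: unmatched_downs_def matching_def matching_from_snoc nth_append less_Suc_eq
      split: if_splits)

lemma disagreement_snoc:
  "length p = length q \<Longrightarrow>
    disagreement (p @ [s]) (q @ [t]) = disagreement p q @ [disagree_step s t]"
  by (simp add: disagreement_def)

lemma length_disagreement: "length p = length q \<Longrightarrow> length (disagreement p q) = length q"
  by (simp add: disagreement_def)

text \<open>The flipped path \<open>r\<close> is kept apart from \<open>p\<close> and
  \<open>q\<close> because both components are flipped at the same positions.\<close>

lemma flip_unmatched_snoc:
  assumes "length r = length q" "length p = length q"
  defines "w \<equiv> disagreement p q"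
  shows "flip_at (unmatched_downs (disagreement (p @ [s]) (q @ [t]))) (r @ [v]) =
    flip_at (unmatched_downs w) r @
      [if s = Down \<and> t = Up \<and> open_ups 0 [] w = [] then flip v else v]"
proof -
  have "disagree_step s t = MD \<longleftrightarrow> s = Down \<and> t = Up"
    by (cases s; cases t) auto
  then show ?thesis
    using assms unmatched_downs_bound[of "length q" w]
    by (auto simp: flip_at_snoc disagreement_snoc unmatched_downs_snoc length_disagreement
        intro!: flip_at_cong)
qed

text \<open>A down step read on an empty stack comes from \<open>Down\<close> over
  \<open>Up\<close>; flipping the latter makes both paths fall, so the difference stays put like the
  stack. Any other step changes both sides by twice its \<open>mrise\<close>.\<close>

lemma length_open_ups:
  assumes "length p = length q"
  shows "2 * int (length (open_ups 0 [] (disagreement p q))) =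
    height p - height (flip_at (unmatched_downs (disagreement p q)) q)"
  using assms
proof (induction p arbitrary: q rule: rev_induct)
  case Nil
  then show ?case by (simp add: disagreement_def flip_at_def)
next
  case (snoc s p)
  then obtain q0 t where q: "q = q0 @ [t]" "length p = length q0"
    by (cases q rule: rev_cases) auto
  from snoc.IH[OF q(2)] show ?case
    unfolding q(1) flip_unmatched_snoc[OF refl q(2)]
    unfolding disagreement_snoc[OF q(2)] open_ups_snoc
    by (cases s; cases t; cases "open_ups 0 [] (disagreement p q0)") auto
qed

section \<open>The map as a transducer\<close>

lemma phi_Nil: "phi ([], []) = ([], [])"
  by (simp add: phi_def flip_at_def flip_below_def)

lemma phi_length:
  "length (fst (phi (p, q))) = length p"
  "length (snd (phi (p, q))) = length q"
  by (simp_all add: phi_def Let_def)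

text \<open>By \<open>length_open_ups\<close> the empty-stack test compares the original
  \<open>p\<close> with the image \<open>Q\<close>.\<close>

lemma phi_snoc:
  assumes "length p = length q" "phi (p, q) = (P, Q)"
  shows "phi (p @ [s], q @ [t]) =
    (let t' = if height q + rise t < 0 then flip t else t
     in if s = Down \<and> t' = Up \<and> height p = height Q then (P @ [Up], Q @ [Down])
        else (P @ [s], Q @ [t']))"
proof -
  let ?w = "disagreement p (flip_below q)"
  have "P = flip_at (unmatched_downs ?w) p" "Q = flip_at (unmatched_downs ?w) (flip_below q)"
    using assms(2) by (auto simp: phi_def Let_def)
  moreover from this have "open_ups 0 [] ?w = [] \<longleftrightarrow> height p = height Q"
    using length_open_ups[of p "flip_below q"] assms(1) by auto
  ultimately show ?thesis
    using assms(1) by (auto simp: phi_def Let_def flip_below_snoc flip_unmatched_snoc)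
qed

text \<open>The condition of \<open>M2\<close> with free end heights, so that it survives removal of
  the last step.\<close>

definition sandwiched :: "step list \<Rightarrow> step list \<Rightarrow> bool" where
  "sandwiched p q \<longleftrightarrow> length p = length q \<and> path_le (reflect p) q \<and> path_le q p"

lemma sandwiched_length: "sandwiched p q \<Longrightarrow> length p = length q"
  by (simp add: sandwiched_def)

lemma sandwiched_Nil [simp]: "sandwiched [] []"
  by (simp add: sandwiched_def path_le_def reflect_def)

lemma sandwiched_snoc:
  assumes "length p = length q"
  shows "sandwiched (p @ [s]) (q @ [t]) \<longleftrightarrow>
    sandwiched p q \<and> \<bar>height q + rise t\<bar> \<le> height p + rise s"
  using assms by (cases s) (auto simp: sandwiched_def path_le_snoc reflect_snoc height_reflect)

lemma sandwiched_phi: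
  assumes "sandwiched p q" "phi (p, q) = (P, Q)"
  shows "path_nonneg Q \<and> path_le Q P \<and> \<bar>height q\<bar> \<le> height Q \<and> height Q \<le> height p
    \<and> height p \<le> height P"
  using assms
proof (induction p arbitrary: q P Q rule: rev_induct)
  case Nil
  then show ?case
    by (auto simp: sandwiched_def phi_Nil path_nonneg_def path_le_def height_at_def)
next
  case (snoc s p)
  then obtain q0 t where q: "q = q0 @ [t]" and len: "length p = length q0"
    by (cases q rule: rev_cases) (auto dest: sandwiched_length)
  obtain P0 Q0 where phi0: "phi (p, q0) = (P0, Q0)"
    by fastforce
  have sw: "sandwiched p q0" and le: "\<bar>height q0 + rise t\<bar> \<le> height p + rise s"
    using snoc.prems(1) by (simp_all add: q sandwiched_snoc[OF len])
  note IH = snoc.IH[OF sw phi0]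
  have lens: "length P0 = length Q0"
    using phi_length[of p q0] len by (simp add: phi0)
  \<comment> \<open>Parity excludes the gap 1, at which an unswapped \<open>Down\<close> over
    \<open>Up\<close> would push \<open>Q\<close> above \<open>p\<close>.\<close>
  have par: "height p \<noteq> height Q0 + 1"
    using height_parity[of p] height_parity[of Q0] len phi_length(2)[of p q0]
    by (auto simp: phi0)
  show ?case
    using snoc.prems(2) IH le par lens[symmetric]
    unfolding q phi_snoc[OF len phi0] Let_def abs_le_iff
    by (cases s; cases t; simp split: if_splits;
        clarsimp simp: path_le_snoc path_nonneg_snoc; linarith?)
qed

lemma phi_inj:
  assumes "sandwiched p q" "sandwiched p' q'" "phi (p, q) = phi (p', q')"
    "height p = height p'" "height q = height q'"
  shows "p = p' \<and> q = q'"
  using assms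
proof (induction p arbitrary: q p' q' rule: rev_induct)
  case Nil
  then show ?case
    using phi_length[of "[]" q] phi_length[of p' q'] by (auto dest: sandwiched_length)
next
  case (snoc s p)
  then obtain q0 t where q: "q = q0 @ [t]" and len: "length p = length q0"
    by (cases q rule: rev_cases) (auto dest: sandwiched_length)
  have "length q' = length q" "length p' = length q'"
    using phi_length(2)[of "p @ [s]" q] phi_length(2)[of p' q'] snoc.prems(2,3)
    by (auto dest: sandwiched_length)
  then obtain p0' s' q0' t' where q': "q' = q0' @ [t']" "p' = p0' @ [s']"
    and len': "length p0' = length q0'"
    by (cases q' rule: rev_cases; cases p' rule: rev_cases) (auto simp: q)
  obtain P Q P' Q' where phi0: "phi (p, q0) = (P, Q)" "phi (p0', q0') = (P', Q')"
    by fastforce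
  have sw: "sandwiched p q0" "sandwiched p0' q0'"
    using snoc.prems(1,2) by (simp_all add: q q' sandwiched_snoc[OF len] sandwiched_snoc[OF len'])
  note bounds = sandwiched_phi[OF sw(1) phi0(1)] sandwiched_phi[OF sw(2) phi0(2)]
  define v where "v = (if height q0 + rise t < 0 then flip t else t)"
  define v' where "v' = (if height q0' + rise t' < 0 then flip t' else t')"
  have heights: "height p + rise s = height p0' + rise s'" "height q0 + rise t = height q0' + rise t'"
    using snoc.prems(4,5) by (simp_all add: q q')
  have "(if s = Down \<and> v = Up \<and> height p = height Q then (P @ [Up], Q @ [Down])
      else (P @ [s], Q @ [v])) =
    (if s' = Down \<and> v' = Up \<and> height p0' = height Q' then (P' @ [Up], Q' @ [Down])
      else (P' @ [s'], Q' @ [v']))"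
    using snoc.prems(3)
    unfolding q q' phi_snoc[OF len phi0(1)] phi_snoc[OF len' phi0(2)] Let_def v_def v'_def .
  \<comment> \<open>If only the first pair were swapped, the images would force
    \<open>s' = Up\<close>, and equal end heights would give
    \<open>height p0' = height Q' - 2\<close>, against \<open>height Q' \<le> height p0'\<close>.
    The other mixed case is symmetric.\<close>
  then have "P = P' \<and> Q = Q' \<and> s = s' \<and> v = v'"
    using bounds heights(1) by (auto split: if_splits)
  \<comment> \<open>The test for a flip reads the end height, which both paths share.\<close>
  moreover from this have "t = t'"
    unfolding v_def v'_def heights(2) by (cases t; cases t') (auto split: if_splits)
  ultimately have "P = P' \<and> Q = Q' \<and> s = s' \<and> t = t'"
    by blast
  then show ?case
    using snoc.IH[OF sw] snoc.prems(4,5) by (auto simp: phi0 q q')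
qed

text \<open>The last transition is undone and the end heights are adjusted; the bounds dictate which
  transition it was.\<close>

lemma phi_surj:
  assumes "length P = length Q" "path_nonneg Q" "path_le Q P"
    "\<bar>y\<bar> \<le> height Q" "height Q \<le> x" "x \<le> height P"
    "even (x + int (length Q))" "even (y + int (length Q))"
  shows "\<exists>p q. sandwiched p q \<and> height p = x \<and> height q = y \<and> phi (p, q) = (P, Q)"
  using assms
proof (induction P arbitrary: Q x y rule: rev_induct)
  case Nil
  then show ?case
    by (auto intro!: exI[of _ "[]"] simp: phi_Nil)
next
  case (snoc S P)
  then obtain Q0 T where Q: "Q = Q0 @ [T]" and len: "length P = length Q0"
    by (cases Q rule: rev_cases) auto
  have nonneg: "path_nonneg Q0" "0 \<le> height Q0 + rise T"
    and le: "path_le Q0 P" "height Q0 + rise T \<le> height P + rise S"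
    using snoc.prems(2,3) len by (auto simp: Q path_nonneg_snoc path_le_snoc)
  note le' = path_le_heightD[OF le(1)] path_nonneg_heightD[OF nonneg(1)]
  \<comment> \<open>If \<open>S = Up\<close> and \<open>T = Down\<close> were unswapped, the
    previous height \<open>x - 1\<close> of \<open>p\<close> would have to be at least
    \<open>height Q0\<close>; this fails exactly at this value of \<open>x\<close>.\<close>
  define swap where "swap \<longleftrightarrow> S = Up \<and> T = Down \<and> x = height Q0 + rise T"
  define s where "s = (if swap then Down else S)"
  define t' where "t' = (if swap then Up else T)"
  \<comment> \<open>The sign of the end height \<open>y\<close> reveals whether the last step was
    flipped by \<open>flip_below\<close>.\<close>
  define t where "t = (if y < 0 then flip t' else t')"
  note defs = swap_def s_def t'_def t_def
  have par: "even (height P + int (length Q0))" "even (height Q0 + int (length Q0))"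
    using height_parity[of P] height_parity[of Q0] len by simp_all
  \<comment> \<open>The end heights differ in parity from the heights one step before. This excludes
    borderline cases such as \<open>y = 0 = height Q0\<close>.\<close>
  have par': "x \<noteq> height P" "x \<noteq> height Q0" "y \<noteq> height Q0" "y \<noteq> - height Q0"
    using par snoc.prems(7,8) by (auto simp: Q)
  have "\<bar>y - rise t\<bar> \<le> height Q0 \<and> height Q0 \<le> x - rise s \<and> x - rise s \<le> height P"
    using snoc.prems(4-6) nonneg(2) le' le(2) par' unfolding abs_le_iff
    by (cases S; cases T; cases "y < 0"; cases swap; simp add: defs Q; linarith?)
  moreover have "even (x - rise s + int (length Q0))" "even (y - rise t + int (length Q0))"
    using snoc.prems(7,8) by (cases s; cases t; simp add: Q; presburger)+
  ultimately obtain p q where pq: "sandwiched p q" "height p = x - rise s"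
    "height q = y - rise t" "phi (p, q) = (P, Q0)"
    using snoc.IH[OF len nonneg(1) le(1)] by metis
  have lpq: "length p = length q"
    using pq(1) by (rule sandwiched_length)
  have "sandwiched (p @ [s]) (q @ [t])"
    using snoc.prems(4-6) by (simp add: sandwiched_snoc[OF lpq] pq)
  moreover have "phi (p @ [s], q @ [t]) = (P @ [S], Q)"
    using snoc.prems(4-6) pq(2,3)
    unfolding phi_snoc[OF lpq pq(4)] Let_def Q
    by (cases S; cases T; cases "y < 0"; cases swap; simp add: defs)
  ultimately show ?case
    using pq(2,3) by (intro exI[of _ "p @ [s]"] exI[of _ "q @ [t]"]) simp
qed

theorem theorem2p1:
  fixes n :: nat and i j :: int
  assumes "0 \<le> j" and "j \<le> i"
    and "i + j \<le> int n"
    and "(i + j) mod 2 = int n mod 2"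
  shows "bij_betw phi (M2 n i j) (P2 n i j)"
proof -
  have M2_iff: "(p, q) \<in> M2 n i j \<longleftrightarrow>
      length q = n \<and> sandwiched p q \<and> height p = i + j \<and> height q = i - j" for p q
    by (auto simp: M2_def sandwiched_def)
  show ?thesis
    unfolding bij_betw_def
  proof (intro conjI equalityI subsetI)
    show "inj_on phi (M2 n i j)"
      by (rule inj_onI) (clarsimp simp: M2_iff, metis phi_inj)
  next
    fix z assume "z \<in> phi ` M2 n i j"
    then obtain p q where pq: "(p, q) \<in> M2 n i j" and z: "phi (p, q) = (fst z, snd z)"
      by auto
    then show "z \<in> P2 n i j"
      using sandwiched_phi[OF _ z] phi_length[of p q] sandwiched_length[of p q]
      by (cases z) (auto simp: M2_iff P2_def)
  next
    fix z assume "z \<in> P2 n i j"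
    then obtain P Q where z: "z = (P, Q)" and len: "length P = n" "length Q = n"
      and PQ: "path_nonneg Q" "path_le Q P" "i - j \<le> height Q" "height Q \<le> i + j"
        "i + j \<le> height P"
      by (auto simp: P2_def)
    have par: "even (i + j + int (length Q))" "even (i - j + int (length Q))"
      using assms(4) len(2) by presburger+
    \<comment> \<open>Since \<open>i - j\<close> is nonnegative, the bounds of \<open>P2\<close>
      become those of \<open>phi_surj\<close> with \<open>x = i + j\<close> and
      \<open>y = i - j\<close>.\<close>
    have "length P = length Q" "\<bar>i - j\<bar> \<le> height Q"
      using len PQ(3) assms(2) by simp_all
    then obtain p q where "sandwiched p q" "height p = i + j" "height q = i - j"
      "phi (p, q) = z"
      using phi_surj[OF _ PQ(1,2) _ PQ(4,5) par] z by blast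
    moreover from this have "length q = n"
      using phi_length(2)[of p q] len(2) z by simp
    ultimately show "z \<in> phi ` M2 n i j"
      by (metis M2_iff imageI)
  qed
qed

end
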